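(* Let $g\in\mathbb{R}$, $g\neq 1$. Then, in the sense of the generalized summation method described in the context, $$\sum_{u=0}^{\infty}g^u=\frac{1}{1-g}.$$
   Context: Re-ordering of $\mathbb{Z}$: $a\prec b$ iff $\frac{-1}{a}<\frac{-1}{b}$ (convention $0^{-1}=\infty$), so that $0\prec 1\prec 2\prec\cdots\prec -2\prec -1$ (first element $0$, last element $-1$). Intervals $[a,b]$, $(a,b)$ are taken with respect to $\prec$. Put $\mathbb{Z}_{a,b}=[a,b]$ if $a\preceq b$, and $\mathbb{Z}_{a,b}=\mathbb{Z}\setminus(b,a)=[a,-1]\cup[0,b]$ if $b\prec a$. For a function $f$ on $\mathbb{Z}$ and any $a,b\in\mathbb{Z}$, $\sum_{u=a}^{b}f(u):=\sum_{u\in\mathbb{Z}_{a,b}}f(u)$ (observing the order of elements in $\mathbb{Z}_{a,b}$); if $\mathbb{Z}_{a,b}$ is infinite this is an infinite series. An elementary function is one given by a formula built by finitely many algebraic operations, compositions and combinations from constant, algebraic, trigonometric and exponential functions and their inverses. A function $f$ on $\mathbb{Z}$ is regular if there is an elementary function $F$ (a primitive of $f$) with $F(x+1)-F(x)=f(x)$ for all $x\in\mathbb{Z}$. Summation method. Postulate: every series $\sum_{u=1}^{\infty}f(u)$ with $f$ regular has a certain finite numeric value. Axioms: (A1) if $S_n=\sum_{u=a}^{n}f(u)$ for all $n$, then $\lim_{n\to\infty}S_n=\sum_{u=a}^{\infty}f(u)$; (A2) if $S_n=\sum_{u=1}^{[n/2]}f(u)$ for all $n$, then $\lim_{n\to\infty}S_n=\sum_{u=1}^{\infty}f(u)$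 ($[\cdot]$ = integer part); (A3) if $\sum_{u=a}^{\infty}f_1(u)=S_1$ and $\sum_{u=a}^{\infty}f_2(u)=S_2$, then $\sum_{u=a}^{\infty}(\alpha_1f_1(u)+\alpha_2f_2(u))=\alpha_1S_1+\alpha_2S_2$; (A4) if $G=[a_1,b_1]\cup[a_2,b_2]$ with $[a_1,b_1]\cap[a_2,b_2]=\emptyset$, then $\sum_{u\in G}f(u)=\sum_{u=a_1}^{b_1}f(u)+\sum_{u=a_2}^{b_2}f(u)$. Limits: $\lim_{n\to\infty}F(n)=A$ means $\sum_{u=1}^{\infty}f(u)=A$ where $f(1)=F(1)$ and $f(u)=F(u)-F(u-1)$ for $u>1$; by the postulate every elementary function of an integer argument defined on $\mathbb{Z}$ has a definite limit. All limits and infinite sums are understood in this generalized sense (agreeing with the usual one for convergent sequences and series). Conventions: sums retain their analytical expression, i.e. for $f$ regular with primitive $F$, $\sum_{u=a}^{b}f(u)=F(b+1)-F(a)$ whenever $a\preceq b$; and $\lim_{n\to\infty}\sum_{u\in\mathbb{Z}_{-n,n}}f(u)=\sum_{u\in\mathbb{Z}}f(u)$. *)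

theory Defs
  imports "HOL-Analysis.Analysis"
begin

section \<open>The re-ordering of the integers\<close>

text \<open>The library convention \<^prop>\<open>inverse (0::ereal) = \<infinity>\<close> makes \<^term>\<open>0::int\<close> the first element.\<close>

definition prec :: "int \<Rightarrow> int \<Rightarrow> bool" where
  "prec a b \<longleftrightarrow> - inverse (ereal (of_int a)) < - inverse (ereal (of_int b))"

definition preceq :: "int \<Rightarrow> int \<Rightarrow> bool" where
  "preceq a b \<longleftrightarrow> prec a b \<or> a = b"

definition closed_int :: "int \<Rightarrow> int \<Rightarrow> int set" where
  "closed_int a b = {u. preceq a u \<and> preceq u b}"

definition open_int :: "int \<Rightarrow> int \<Rightarrow> int set" where
  "open_int a b = {u. prec a u \<and> prec u b}"

definition Zab :: "int \<Rightarrow> int \<Rightarrow> int set" where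
  "Zab a b = (if preceq a b then closed_int a b else UNIV - open_int b a)"

text \<open>Sanity checks: \<open>0 \<prec> 1 \<prec> 2 \<prec> \<dots> \<prec> -2 \<prec> -1\<close>.\<close>

lemma prec_iff: "prec a b \<longleftrightarrow> (0 \<le> a \<and> b < 0) \<or> ((0 \<le> a \<longleftrightarrow> 0 \<le> b) \<and> a < b)"
proof (cases "a = 0 \<or> b = 0")
  case True
  then show ?thesis by (auto simp: prec_def)
next
  case False
  then consider "a > 0" "b > 0" | "a > 0" "b < 0" | "a < 0" "b > 0" | "a < 0" "b < 0"
    by linarith
  then show ?thesis
    by cases (simp_all add: prec_def divide_simps)
qed

lemma Zab_wrap: "prec b a \<Longrightarrow> Zab a b = closed_int a (-1) \<union> closed_int 0 b"
proof -
  assume ba: "prec b a"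
  then have "\<not> preceq a b" by (simp add: preceq_def prec_iff) arith
  moreover have "preceq a u \<longleftrightarrow> \<not> prec u a" "preceq u b \<longleftrightarrow> \<not> prec b u"
    "preceq u (-1)" "preceq 0 u" for u
    unfolding preceq_def prec_iff by arith+
  ultimately show ?thesis
    unfolding Zab_def closed_int_def open_int_def by auto
qed

section \<open>Elementary functions\<close>

text \<open>
  Elementary functions are partial real functions, so that a formula such as \<open>1 / x\<close> is
  really undefined at \<open>0\<close>. An algebraic function is a continuous branch, on an interval, of
  the solutions of a polynomial equation \<open>P(x, y) = 0\<close>; the outer variable of the
  bivariate polynomial \<open>P\<close> is \<open>y\<close>.
\<close>

definition on_dom :: "real set \<Rightarrow> (real \<Rightarrow> real) \<Rightarrow> (real \<rightharpoonup> real)" where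
  "on_dom D h = (\<lambda>x. if x \<in> D then Some (h x) else None)"

definition total_map :: "(real \<Rightarrow> real) \<Rightarrow> (real \<rightharpoonup> real)" where
  "total_map h = (\<lambda>x. Some (h x))"

definition pmap2 ::
    "(real \<Rightarrow> real \<Rightarrow> real) \<Rightarrow> (real \<rightharpoonup> real) \<Rightarrow> (real \<rightharpoonup> real) \<Rightarrow> (real \<rightharpoonup> real)" where
  "pmap2 h F G = (\<lambda>x. case (F x, G x) of (Some s, Some t) \<Rightarrow> Some (h s t) | _ \<Rightarrow> None)"

definition pdiv :: "(real \<rightharpoonup> real) \<Rightarrow> (real \<rightharpoonup> real) \<Rightarrow> (real \<rightharpoonup> real)" where
  "pdiv F G = (\<lambda>x. case (F x, G x) of
      (Some s, Some t) \<Rightarrow> if t = 0 then None else Some (s / t) | _ \<Rightarrow> None)"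

inductive elementary :: "(real \<rightharpoonup> real) \<Rightarrow> bool" where
  el_const: "elementary (total_map (\<lambda>_. c))"
| el_id: "elementary (total_map (\<lambda>x. x))"
| el_algebraic: "is_interval D \<Longrightarrow> continuous_on D h \<Longrightarrow> (P :: real poly poly) \<noteq> 0 \<Longrightarrow>
    (\<And>x. x \<in> D \<Longrightarrow> poly (poly P [:h x:]) x = 0) \<Longrightarrow> elementary (on_dom D h)"
| el_exp: "elementary (total_map exp)"
| el_ln: "elementary (on_dom {0<..} ln)"
| el_sin: "elementary (total_map sin)"
| el_cos: "elementary (total_map cos)"
| el_arcsin: "elementary (on_dom {-1..1} arcsin)"
| el_arccos: "elementary (on_dom {-1..1} arccos)"
| el_arctan: "elementary (total_map arctan)"
| el_add: "elementary F \<Longrightarrow> elementary G \<Longrightarrow> elementary (pmap2 (+) F G)"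
| el_diff: "elementary F \<Longrightarrow> elementary G \<Longrightarrow> elementary (pmap2 (-) F G)"
| el_mult: "elementary F \<Longrightarrow> elementary G \<Longrightarrow> elementary (pmap2 (*) F G)"
| el_div: "elementary F \<Longrightarrow> elementary G \<Longrightarrow> elementary (pdiv F G)"
| el_comp: "elementary F \<Longrightarrow> elementary G \<Longrightarrow> elementary (F \<circ>\<^sub>m G)"

text \<open>
  The summation method is considered relative to a class \<open>E\<close> of elementary functions that are
  admitted as primitives. The class of all elementary functions is admissible (lemma below),
  and for it one gets the method as usually stated. The parameter is there because the
  requirements on a summation method cannot all hold for that full class: with
  \<open>F(x) = 1 / (1 + 2 ^ x)\<close> and \<open>f(x) = F(x+1) - F(x)\<close> the sum of \<open>f\<close> over all
  integers is \<open>F(0) - F(0) = 0\<close>, yet its symmetric partial sums \<open>F(n+1) - F(-n)\<close>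
  converge to \<open>-1\<close>. They can all hold for smaller admissible classes, e.g. the real span of the
  functions \<open>x ^ k * exp (c * x) * cos (d * x)\<close> and \<open>x ^ k * exp (c * x) * sin (d * x)\<close>.
\<close>

definition admissible_class :: "(real \<rightharpoonup> real) set \<Rightarrow> bool" where
  "admissible_class E \<longleftrightarrow>
     E \<subseteq> Collect elementary \<and>
     (\<forall>c. total_map (\<lambda>_. c) \<in> E) \<and>
     total_map (\<lambda>x. x) \<in> E \<and> total_map exp \<in> E \<and> total_map sin \<in> E \<and> total_map cos \<in> E \<and>
     (\<forall>F\<in>E. \<forall>G\<in>E. pmap2 (+) F G \<in> E \<and> pmap2 (*) F G \<in> E) \<and>
     (\<forall>F\<in>E. \<forall>a b. F \<circ>\<^sub>m total_map (\<lambda>x. a * x + b) \<in> E)"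

lemma admissible_class_elementary: "admissible_class (Collect elementary)"
proof -
  have "elementary (total_map (\<lambda>x. a * x + b))" for a b
  proof -
    have "total_map (\<lambda>x. a * x + b) =
        pmap2 (+) (pmap2 (*) (total_map (\<lambda>_. a)) (total_map (\<lambda>x. x))) (total_map (\<lambda>_. b))"
      by (simp add: total_map_def pmap2_def)
    then show ?thesis by (metis el_add el_mult el_const el_id)
  qed
  then show ?thesis
    unfolding admissible_class_def
    by (auto intro: elementary.intros)
qed

definition primitive_of :: "(real \<rightharpoonup> real) \<Rightarrow> (int \<Rightarrow> real) \<Rightarrow> bool" where
  "primitive_of F f \<longleftrightarrow> (\<forall>x::int. of_int x \<in> dom F \<and>
     the (F (of_int (x + 1))) - the (F (of_int x)) = f x)"

definition regular :: "(real \<rightharpoonup> real) set \<Rightarrow> (int \<Rightarrow> real) \<Rightarrow> bool" where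
  "regular E f \<longleftrightarrow> (\<exists>F\<in>E. primitive_of F f)"

section \<open>The summation method\<close>

text \<open>
  \<open>series a f\<close> is the value of the series \<open>\<Sum>u=a..\<infinity>. f u\<close> (\<^const>\<open>None\<close> if the method assigns none),
  \<open>isum A f\<close> is the sum of \<open>f\<close> over a set of integers such as \<^term>\<open>Zab a b\<close>.
  The generalized limit of \<open>F\<close> only involves the values \<open>F n\<close> for \<open>n \<ge> 1\<close>, because
  \<open>series 1 f\<close> only depends on \<open>f\<close> on the positive integers (\<open>series_cong\<close> below).
\<close>

definition glim :: "(int \<Rightarrow> (int \<Rightarrow> real) \<Rightarrow> real option) \<Rightarrow> (int \<Rightarrow> real) \<Rightarrow> real option" where
  "glim series F = series 1 (\<lambda>u. if u = 1 then F 1 else F u - F (u - 1))"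

locale summation_method =
  fixes E :: "(real \<rightharpoonup> real) set"
    and isum :: "int set \<Rightarrow> (int \<Rightarrow> real) \<Rightarrow> real"
    and series :: "int \<Rightarrow> (int \<Rightarrow> real) \<Rightarrow> real option"
  assumes admissible: "admissible_class E"
    \<comment> \<open>a sum depends on its terms only; finite and convergent sums are the usual ones\<close>
    and isum_cong: "(\<And>u. u \<in> A \<Longrightarrow> f u = f' u) \<Longrightarrow> isum A f = isum A f'"
    and series_cong: "(\<And>u. a \<le> u \<Longrightarrow> f u = f' u) \<Longrightarrow> series a f = series a f'"
    and isum_finite: "finite A \<Longrightarrow> isum A f = sum f A"
    and series_convergent: "(\<lambda>k. f (a + int k)) sums s \<Longrightarrow> series a f = Some s"
    \<comment> \<open>the postulate and the axioms\<close>
    and postulate: "regular E f \<Longrightarrow> \<exists>s. series 1 f = Some s"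
    and A1: "regular E f \<Longrightarrow> glim series (\<lambda>n. isum (Zab a n) f) = series a f"
    and A2: "regular E f \<Longrightarrow> glim series (\<lambda>n. isum (Zab 1 (n div 2)) f) = series 1 f"
    and A3: "series a f1 = Some s1 \<Longrightarrow> series a f2 = Some s2 \<Longrightarrow>
      series a (\<lambda>u. \<alpha>1 * f1 u + \<alpha>2 * f2 u) = Some (\<alpha>1 * s1 + \<alpha>2 * s2)"
    and A4: "regular E f \<Longrightarrow> preceq a1 b1 \<Longrightarrow> preceq a2 b2 \<Longrightarrow>
      closed_int a1 b1 \<inter> closed_int a2 b2 = {} \<Longrightarrow>
      isum (closed_int a1 b1 \<union> closed_int a2 b2) f =
        isum (closed_int a1 b1) f + isum (closed_int a2 b2) f"
    \<comment> \<open>the conventions on infinite intervals\<close>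
    and analytic_expression: "F \<in> E \<Longrightarrow> primitive_of F f \<Longrightarrow> preceq a b \<Longrightarrow>
      isum (Zab a b) f = the (F (of_int (b + 1))) - the (F (of_int a))"
    and symmetric_limit: "regular E f \<Longrightarrow>
      glim series (\<lambda>n. isum (Zab (- n) n) f) = Some (isum UNIV f)"

end

(* The series of a regular function over all of \<int> is F(0) - F(0) = 0, and it is also the limit
   of the symmetric partial sums. Hence f(0) + sum_{u\<ge>1} f(u) + sum_{u\<ge>1} f(-u) = 0, so
   sum_{u\<ge>0} f(u) = - sum_{u\<ge>1} f(-u). For f(u) = g^u with |g| > 1 the right-hand side is a
   convergent geometric series; for g = -1 both series over u \<ge> 1 have the same terms. *)

theory Submission
  imports Defs
begin

lemma closed_int_nonneg: "0 \<le> a \<Longrightarrow> 0 \<le> b \<Longrightarrow> closed_int a b = {a..b}"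
  by (auto simp: closed_int_def preceq_def prec_iff)

lemma closed_int_neg: "a < 0 \<Longrightarrow> b < 0 \<Longrightarrow> closed_int a b = {a..b}"
  by (auto simp: closed_int_def preceq_def prec_iff)

lemma Zab_nonneg: "0 \<le> a \<Longrightarrow> a \<le> b \<Longrightarrow> Zab a b = {a..b}"
  by (simp add: Zab_def closed_int_nonneg) (auto simp: preceq_def prec_iff)

text \<open>As \<open>n\<close> precedes \<open>- n\<close>, this is the wrap-around case: the
  segment runs from \<open>- n\<close> up to -1, the last element, and resumes at 0, the
  first.\<close>

lemma Zab_symmetric:
  assumes "0 < n"
  shows "Zab (- n) n = {- n..n}"
proof -
  have "Zab (- n) n = closed_int (- n) (-1) \<union> closed_int 0 n"
    using assms by (intro Zab_wrap) (simp add: prec_iff)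
  also have "\<dots> = {- n..-1} \<union> {0..n}"
    using assms by (simp add: closed_int_neg closed_int_nonneg)
  finally show ?thesis using assms by auto
qed

lemma Zab_UNIV: "Zab 0 (-1) = UNIV"
  by (auto simp: Zab_def closed_int_def preceq_def prec_iff)

text \<open>Admissible classes guarantee \<open>exp\<close>, \<open>cos\<close> and affine
  substitution, but no power with a negative base; the factor cos(pi k) = (-1)^k carries the sign of
  \<open>g\<close>.\<close>

lemma powi_eq_exp_cos:
  fixes g :: real
  assumes "g \<noteq> 0"
  shows "g powi k = exp (ln \<bar>g\<bar> * of_int k) * cos ((if g < 0 then pi else 0) * of_int k)"
proof -
  have exp_powi: "exp (ln \<bar>g\<bar> * of_int k) = \<bar>g\<bar> powi k"
    using assms powr_real_of_int'[of "\<bar>g\<bar>" k] by (simp add: powr_def mult.commute)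
  show ?thesis
  proof (cases "g < 0")
    case True
    have "g powi k = ((-1) * \<bar>g\<bar>) powi k" using True by simp
    also have "\<dots> = (-1) powi k * \<bar>g\<bar> powi k" by (rule power_int_mult_distrib)
    also have "(-1) powi k = cos (pi * of_int k)"
      by (simp add: power_int_minus_left cos_int_times_real mult.commute)
    finally show ?thesis using True exp_powi by simp
  next
    case False
    then show ?thesis using exp_powi by simp
  qed
qed

lemma regular_powi:
  fixes g :: real
  assumes E: "admissible_class E" and g: "g \<noteq> 0" "g \<noteq> 1"
  shows "regular E (\<lambda>u. g powi u)"
proof -
  let ?c = "if g < 0 then pi else 0"
  \<comment> \<open>The primitive is g^x / (g - 1), the telescoping form of a geometric sum. The
    summands \<open>+ 0\<close> match the affine maps a x + b of the closure condition.\<close>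
  let ?F = "pmap2 (*) (total_map (\<lambda>_. 1 / (g - 1)))
    (pmap2 (*) (total_map exp \<circ>\<^sub>m total_map (\<lambda>x. ln \<bar>g\<bar> * x + 0))
      (total_map cos \<circ>\<^sub>m total_map (\<lambda>x. ?c * x + 0)))"
  have "?F \<in> E" using E unfolding admissible_class_def by blast
  moreover have F: "?F (of_int x) = Some (g powi x / (g - 1))" for x
    unfolding powi_eq_exp_cos[OF g(1)] by (simp add: total_map_def pmap2_def map_comp_def)
  have "g powi (x + 1) / (g - 1) - g powi x / (g - 1) = g powi x" for x
  proof -
    have "g powi (x + 1) - g powi x = g powi x * (g - 1)"
      using g by (simp add: power_int_add algebra_simps)
    then show ?thesis using g by (simp flip: diff_divide_distrib)
  qed
  then have "primitive_of ?F (\<lambda>u. g powi u)"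
    unfolding primitive_of_def dom_def mem_Collect_eq F option.sel by simp
  ultimately show ?thesis unfolding regular_def by blast
qed

context summation_method
begin

text \<open>Generalized limits start at n = 1, so a term at 0 ends up inside the first term of the
  series; this series splits it off.\<close>

lemma series_single: "series 1 (\<lambda>u. if u = 1 then c else 0) = Some c"
proof (rule series_convergent)
  show "(\<lambda>k. if 1 + int k = 1 then c else 0) sums c"
    using sums_single[of 0 "\<lambda>_. c"] by (simp cong: if_cong)
qed

lemma series_add:
  "series a f1 = Some s1 \<Longrightarrow> series a f2 = Some s2 \<Longrightarrow>
    series a (\<lambda>u. f1 u + f2 u) = Some (s1 + s2)"
  using A3[of a f1 s1 f2 s2 1 1] by simp

lemma series_from_0:
  assumes "regular E f" "series 1 f = Some t"
  shows "series 0 f = Some (f 0 + t)"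
proof -
  have "series 0 f = glim series (\<lambda>n. isum (Zab 0 n) f)"
    using A1[OF assms(1)] by simp
  \<comment> \<open>Differences of consecutive partial sums are \<open>f u\<close>, but the first
    entry is the whole partial sum f 0 + f 1.\<close>
  also have "\<dots> = series 1 (\<lambda>u. (if u = 1 then f 0 else 0) + f u)"
    unfolding glim_def
  proof (rule series_cong)
    fix u :: int assume u: "1 \<le> u"
    have "{0..u} = insert u {0..u - 1}" using u by auto
    then have "sum f {0..u} = f u + sum f {0..u - 1}" by simp
    then show "(if u = 1 then isum (Zab 0 1) f else isum (Zab 0 u) f - isum (Zab 0 (u - 1)) f)
        = (if u = 1 then f 0 else 0) + f u"
      using u by (auto simp: Zab_nonneg isum_finite)
  qed
  also have "\<dots> = Some (f 0 + t)"
    by (intro series_add series_single assms(2))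
  finally show ?thesis .
qed

text \<open>All integers form the interval from 0 to -1, and the upper endpoint enters the analytic
  expression shifted by one: F(-1 + 1) - F(0).\<close>

lemma isum_UNIV_eq_0:
  assumes "regular E f"
  shows "isum UNIV f = 0"
proof -
  obtain F where "F \<in> E" "primitive_of F f" using assms by (auto simp: regular_def)
  from analytic_expression[OF this, of 0 "-1"] show ?thesis
    by (simp add: Zab_UNIV preceq_def prec_iff)
qed

lemma isum_UNIV_split:
  assumes "regular E f" "series 1 f = Some t" "series 1 (\<lambda>u. f (- u)) = Some t'"
  shows "isum UNIV f = f 0 + (t + t')"
proof -
  have "Some (isum UNIV f) = glim series (\<lambda>n. isum (Zab (- n) n) f)"
    using symmetric_limit[OF assms(1)] by simp
  also have "\<dots> = series 1 (\<lambda>u. (if u = 1 then f 0 else 0) + (f u + f (- u)))"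
    unfolding glim_def
  proof (rule series_cong)
    fix u :: int assume u: "1 \<le> u"
    \<comment> \<open>Each step adds the two endpoints. For \<open>u = 1\<close> the inner interval
      is {0}, which accounts for the extra \<open>f 0\<close>.\<close>
    have "{- u..u} = insert u (insert (- u) {- (u - 1)..u - 1})" using u by auto
    then have "sum f {- u..u} = f u + (f (- u) + sum f {- (u - 1)..u - 1})"
      using u by simp
    then show "(if u = 1 then isum (Zab (- 1) 1) f
          else isum (Zab (- u) u) f - isum (Zab (- (u - 1)) (u - 1)) f)
        = (if u = 1 then f 0 else 0) + (f u + f (- u))"
      using u Zab_symmetric[of u] Zab_symmetric[of "u - 1"] by (auto simp: isum_finite)
  qed
  also have "\<dots> = Some (f 0 + (t + t'))"
    by (intro series_add series_single assms)
  finally show ?thesis by simp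
qed

lemma series_0_reflect:
  assumes "regular E f" "series 1 (\<lambda>u. f (- u)) = Some t'"
  shows "series 0 f = Some (- t')"
proof -
  \<comment> \<open>The value t may stay unknown: it only has to exist for the total to be split,
    and then f 0 + t is determined by t'.\<close>
  obtain t where t: "series 1 f = Some t" using postulate[OF assms(1)] by blast
  have "f 0 + t = - t'"
    using isum_UNIV_split[OF assms(1) t assms(2)] isum_UNIV_eq_0[OF assms(1)] by simp
  then show ?thesis using series_from_0[OF assms(1) t] by simp
qed

end

theorem theorem4p33:
  fixes g :: real
    and E :: "(real \<rightharpoonup> real) set"
    and isum :: "int set \<Rightarrow> (int \<Rightarrow> real) \<Rightarrow> real"
    and series :: "int \<Rightarrow> (int \<Rightarrow> real) \<Rightarrow> real option"
  assumes "summation_method E isum series"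
    and "g \<noteq> 1"
  shows "series 0 (\<lambda>u. g powi u) = Some (1 / (1 - g))"
proof -
  interpret summation_method E isum series by fact
  consider "\<bar>g\<bar> < 1" | "g = -1" | "\<bar>g\<bar> > 1" using assms(2) by linarith
  then show ?thesis
  proof cases
    \<comment> \<open>Ordinary convergence; g = 0 belongs here, with 0 powi 0 = 1.\<close>
    case 1
    show ?thesis
      by (rule series_convergent) (use geometric_sums[of g] 1 in simp)
  next
    case 2
    have reg: "regular E (\<lambda>u. g powi u)"
      using regular_powi[OF admissible, of g] 2 by simp
    obtain t where t: "series 1 (\<lambda>u. g powi u) = Some t" using postulate[OF reg] by blast
    moreover have "(\<lambda>u. g powi (- u)) = (\<lambda>u. g powi u)"
      using 2 by (simp add: power_int_minus flip: power_int_inverse)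
    ultimately have "series 0 (\<lambda>u. g powi u) = Some (- t)"
      using series_0_reflect[OF reg] by simp
    moreover have "series 0 (\<lambda>u. g powi u) = Some (1 + t)"
      using series_from_0[OF reg t] by simp
    \<comment> \<open>Comparing both values gives 1 + t = - t, so t = -1/2 and the sum is 1/2 = 1 /
      (1 - g).\<close>
    ultimately show ?thesis using 2 by simp
  next
    case 3
    have reg: "regular E (\<lambda>u. g powi u)"
      by (rule regular_powi[OF admissible]) (use 3 in auto)
    \<comment> \<open>The reflected series has ratio 1/g, of modulus below 1; it starts at u = 1,
      hence the leading factor 1/g.\<close>
    have "(\<lambda>k. inverse g * inverse g ^ k) sums (inverse g * (1 / (1 - inverse g)))"
      using 3 by (intro sums_mult geometric_sums) (simp add: field_simps)
    also have "inverse g * (1 / (1 - inverse g)) = - (1 / (1 - g))"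
      using 3 by (auto simp: field_simps)
    also have "(\<lambda>k. inverse g * inverse g ^ k) = (\<lambda>k. g powi (- (1 + int k)))"
    proof
      fix k
      have "g powi (- (1 + int k)) = inverse (g powi int (Suc k))"
        unfolding power_int_minus by simp
      then show "inverse g * inverse g ^ k = g powi (- (1 + int k))"
        by (simp only: power_int_of_nat) (simp add: power_inverse)
    qed
    finally have "series 1 (\<lambda>u. g powi (- u)) = Some (- (1 / (1 - g)))"
      by (rule series_convergent)
    from series_0_reflect[OF reg this] show ?thesis by simp
  qed
qed

end
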